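(* Let $w=A_1\ldots A_n$ be a step sequence over a comtrace alphabet $\Theta$, and let $\Pi^\perp$ be the projection representation of the comtrace $[w]$. Then \[A_1\subseteq M(\Pi^\perp).\]
   Context: A comtrace alphabet is $\Theta=(\Sigma,\mathit{sim},\mathit{ser})$ with $\mathit{ser}\subseteq\mathit{sim}\subseteq\Sigma\times\Sigma$, $\mathit{sim}$ irreflexive and symmetric. Steps $\mathbb{S}$ are nonempty sets of pairwise $\mathit{sim}$-related actions; comtrace equivalence $\equiv_\Theta$ is the reflexive, symmetric, transitive closure of $uABz\sim u(A\cup B)z$ for $A\times B\subseteq\mathit{ser}$, and $[w]$ denotes the comtrace (equivalence class) of $w$. Derived relations: $\mathit{dep}=(\Sigma\times\Sigma)\setminus\mathit{sim}$, $\mathit{ind}=\mathit{ser}\cap\mathit{ser}^{-1}$, $\mathit{sin}=\mathit{sim}\setminus\mathit{ser}$, $\mathit{ssm}=\mathit{sim}\setminus(\mathit{ser}\cup\mathit{ser}^{-1})$, $\mathit{wdp}=\mathit{ser}^{-1}\setminus\mathit{ser}$. For $(a,b)\notin\mathit{ind}$ (possibly $a=b$), the projection $\Pi^\perp_{a,b}:\mathbb{S}^*\to(\Sigma\cup\{\perp\})^*$ is defined on a step $A$ by: $\epsilon$ if $\{a,b\}\cap A=\emptyset$; $a$ if $a\in A,b\notin A$ (symmetrically $b$ if $b\in A$, $a\notin A$); $ba$ if $\{a,b\}\subseteq A$ and $(a,b)\in\mathit{wdp}$; $ab$ if $\{a,b\}\subseteq A$ and $(b,a)\in\mathit{wdp}$;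 $\perp$ if $\{a,b\}\subseteq A$ and $(a,b)\in\mathit{ssm}$; and extended to step sequences by concatenation. The projection representation of a comtrace $\tau$ is $\Pi^\perp_\tau(a,b)=\Pi^\perp_{a,b}(\tau)$ on $(\Sigma\times\Sigma)\setminus\mathit{ind}$; any function $\Pi^\perp:(\Sigma\times\Sigma)\setminus\mathit{ind}\to(\Sigma\cup\{\perp\})^*$ is a projection set. For a word $x$, write $x[1]$ for its first letter (its 1-prefix) and $x[1..2]$ for its first two letters (its 2-prefix). An action $a$ is conditionally possible for $\Pi^\perp$ iff for all $b\in\Sigma$: $(a,b)\in\mathit{dep}\Rightarrow \Pi^\perp(a,b)[1]=a$; $(b,a)\in\mathit{wdp}\Rightarrow \Pi^\perp(a,b)[1]=a$; $(a,b)\in\mathit{wdp}\Rightarrow \Pi^\perp(a,b)[1]=a$ or $\Pi^\perp(a,b)[1..2]=ba$; $(a,b)\in\mathit{ssm}\Rightarrow \Pi^\perp(a,b)[1]=a$ or $\Pi^\perp(a,b)[1]=\perp$. Let $cpa$ be the set of conditionally possible actions. Define $(a,b)\in cnd$ iff ($(a,b)\in\mathit{wdp}$ and $\Pi^\perp(a,b)[1..2]=ba$) or ($(a,b)\in\mathit{ssm}$ and $\Pi^\perp(a,b)[1]=\perp$). The set $imp$ of impossible actions is the smallest set with $\Sigma\setminus cpa\subseteq imp$ and ($b\in imp\wedge(a,b)\in cnd\Rightarrow a\in imp$). $M(\Pi^\perp)=\Sigma\setminus imp$ is the set of possible actions. *)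

theory Defs
  imports Main "HOL-Library.FuncSet"
begin

record 'a comtrace_alphabet =
  actions :: "'a set"
  sim :: "('a \<times> 'a) set"
  ser :: "('a \<times> 'a) set"

definition comtrace_alphabet :: "'a comtrace_alphabet \<Rightarrow> bool" where
  "comtrace_alphabet \<Theta> \<longleftrightarrow>
     ser \<Theta> \<subseteq> sim \<Theta> \<and> sim \<Theta> \<subseteq> actions \<Theta> \<times> actions \<Theta> \<and> irrefl (sim \<Theta>) \<and> sym (sim \<Theta>)"

definition dep :: "'a comtrace_alphabet \<Rightarrow> ('a \<times> 'a) set" where
  "dep \<Theta> = (actions \<Theta> \<times> actions \<Theta>) - sim \<Theta>"

definition ind :: "'a comtrace_alphabet \<Rightarrow> ('a \<times> 'a) set" where
  "ind \<Theta> = ser \<Theta> \<inter> (ser \<Theta>)\<inverse>"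

definition ssm :: "'a comtrace_alphabet \<Rightarrow> ('a \<times> 'a) set" where
  "ssm \<Theta> = sim \<Theta> - (ser \<Theta> \<union> (ser \<Theta>)\<inverse>)"

definition wdp :: "'a comtrace_alphabet \<Rightarrow> ('a \<times> 'a) set" where
  "wdp \<Theta> = (ser \<Theta>)\<inverse> - ser \<Theta>"

definition steps :: "'a comtrace_alphabet \<Rightarrow> 'a set set" where
  "steps \<Theta> = {A. A \<noteq> {} \<and> A \<subseteq> actions \<Theta> \<and> (\<forall>a\<in>A. \<forall>b\<in>A. a \<noteq> b \<longrightarrow> (a, b) \<in> sim \<Theta>)}"

inductive serialises :: "'a comtrace_alphabet \<Rightarrow> 'a set list \<Rightarrow> 'a set list \<Rightarrow> bool"
  for \<Theta> where
  "\<lbrakk>u \<in> lists (steps \<Theta>); z \<in> lists (steps \<Theta>); A \<in> steps \<Theta>; B \<in> steps \<Theta>; A \<times> B \<subseteq> ser \<Theta>\<rbrakk>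
    \<Longrightarrow> serialises \<Theta> (u @ [A, B] @ z) (u @ [A \<union> B] @ z)"

definition comtrace_equiv :: "'a comtrace_alphabet \<Rightarrow> 'a set list \<Rightarrow> 'a set list \<Rightarrow> bool" where
  "comtrace_equiv \<Theta> = equivclp (serialises \<Theta>)"

definition comtrace :: "'a comtrace_alphabet \<Rightarrow> 'a set list \<Rightarrow> 'a set list set" where
  "comtrace \<Theta> w = {v. comtrace_equiv \<Theta> w v}"

datatype 'a letter = Act 'a | Perp

text \<open>For \<^term>\<open>a = b\<close> the set \<^term>\<open>{a, b} \<inter> A\<close> is empty or a singleton, and a step containing
  \<^term>\<open>a\<close> is projected to the one-letter word. If \<^term>\<open>A\<close> is a step
  and \<^term>\<open>(a, b) \<notin> ind \<Theta>\<close>, the final \<^term>\<open>undefined\<close> is never reached.\<close>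

definition proj_step :: "'a comtrace_alphabet \<Rightarrow> 'a \<Rightarrow> 'a \<Rightarrow> 'a set \<Rightarrow> 'a letter list" where
  "proj_step \<Theta> a b A =
     (if {a, b} \<inter> A = {} then []
      else if {a, b} \<inter> A = {a} then [Act a]
      else if {a, b} \<inter> A = {b} then [Act b]
      else if (a, b) \<in> wdp \<Theta> then [Act b, Act a]
      else if (b, a) \<in> wdp \<Theta> then [Act a, Act b]
      else if (a, b) \<in> ssm \<Theta> then [Perp]
      else undefined)"

definition proj :: "'a comtrace_alphabet \<Rightarrow> 'a \<Rightarrow> 'a \<Rightarrow> 'a set list \<Rightarrow> 'a letter list" where
  "proj \<Theta> a b w = concat (map (proj_step \<Theta> a b) w)"

type_synonym 'a projection_set = "'a \<times> 'a \<Rightarrow> 'a letter list"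

text \<open>The value at \<^term>\<open>(a, b)\<close> is the common projection of all representatives of the
  comtrace \<^term>\<open>\<tau>\<close>; its existence is lemma \<open>projection_rep_comtrace\<close> below.\<close>

definition projection_rep ::
    "'a comtrace_alphabet \<Rightarrow> 'a set list set \<Rightarrow> 'a projection_set" where
  "projection_rep \<Theta> \<tau> =
     (\<lambda>(a, b) \<in> (actions \<Theta> \<times> actions \<Theta>) - ind \<Theta>. the_elem (proj \<Theta> a b ` \<tau>))"

definition cpa :: "'a comtrace_alphabet \<Rightarrow> 'a projection_set \<Rightarrow> 'a set" where
  "cpa \<Theta> P = {a \<in> actions \<Theta>. \<forall>b \<in> actions \<Theta>.
     ((a, b) \<in> dep \<Theta> \<longrightarrow> take 1 (P (a, b)) = [Act a]) \<and>
     ((b, a) \<in> wdp \<Theta> \<longrightarrow> take 1 (P (a, b)) = [Act a]) \<and>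
     ((a, b) \<in> wdp \<Theta> \<longrightarrow> take 1 (P (a, b)) = [Act a] \<or> take 2 (P (a, b)) = [Act b, Act a]) \<and>
     ((a, b) \<in> ssm \<Theta> \<longrightarrow> take 1 (P (a, b)) = [Act a] \<or> take 1 (P (a, b)) = [Perp])}"

definition cnd :: "'a comtrace_alphabet \<Rightarrow> 'a projection_set \<Rightarrow> ('a \<times> 'a) set" where
  "cnd \<Theta> P = {(a, b).
     (a, b) \<in> wdp \<Theta> \<and> take 2 (P (a, b)) = [Act b, Act a] \<or>
     (a, b) \<in> ssm \<Theta> \<and> take 1 (P (a, b)) = [Perp]}"

inductive_set imp :: "'a comtrace_alphabet \<Rightarrow> 'a projection_set \<Rightarrow> 'a set"
  for \<Theta> P where
  base: "a \<in> actions \<Theta> - cpa \<Theta> P \<Longrightarrow> a \<in> imp \<Theta> P"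
| step: "b \<in> imp \<Theta> P \<Longrightarrow> (a, b) \<in> cnd \<Theta> P \<Longrightarrow> a \<in> imp \<Theta> P"

definition possible :: "'a comtrace_alphabet \<Rightarrow> 'a projection_set \<Rightarrow> 'a set" where
  "possible \<Theta> P = actions \<Theta> - imp \<Theta> P"

lemma proj_step_union:
  assumes "comtrace_alphabet \<Theta>" "A \<in> steps \<Theta>" "B \<in> steps \<Theta>" "A \<times> B \<subseteq> ser \<Theta>" "(a, b) \<notin> ind \<Theta>"
  shows "proj_step \<Theta> a b A @ proj_step \<Theta> a b B = proj_step \<Theta> a b (A \<union> B)"
proof -
  have irr: "(x, x) \<notin> ser \<Theta>" for x
    using assms(1) by (auto simp: comtrace_alphabet_def irrefl_def)
  have a: "a \<in> A \<Longrightarrow> a \<notin> B" and b: "b \<in> A \<Longrightarrow> b \<notin> B"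
    using assms(4) irr by blast+
  have ab: "a \<in> A \<Longrightarrow> b \<in> B \<Longrightarrow> (b, a) \<in> wdp \<Theta> \<and> (a, b) \<notin> wdp \<Theta>"
    and ba: "b \<in> A \<Longrightarrow> a \<in> B \<Longrightarrow> (a, b) \<in> wdp \<Theta>"
    using assms(4,5) unfolding wdp_def ind_def by blast+
  consider "a \<notin> A" "b \<notin> A" | "a \<notin> B" "b \<notin> B"
    | "a \<in> A" "a \<notin> B" "b \<notin> A" "b \<in> B" | "a \<notin> A" "a \<in> B" "b \<in> A" "b \<notin> B"
    using a b by blast
  then show ?thesis
  proof cases
    case 1
    then have "{a, b} \<inter> A = {}" "{a, b} \<inter> (A \<union> B) = {a, b} \<inter> B" by blast+
    then show ?thesis by (simp only: proj_step_def simp_thms if_True append_Nil)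
  next
    case 2
    then have "{a, b} \<inter> B = {}" "{a, b} \<inter> (A \<union> B) = {a, b} \<inter> A" by blast+
    then show ?thesis by (simp only: proj_step_def simp_thms if_True append_Nil2)
  next
    case 3
    with ab have "(b, a) \<in> wdp \<Theta>" "(a, b) \<notin> wdp \<Theta>" by blast+
    moreover from 3 have "a \<noteq> b" by blast
    ultimately show ?thesis using 3 by (simp add: proj_step_def doubleton_eq_iff)
  next
    case 4
    with ba have "(a, b) \<in> wdp \<Theta>" by blast
    moreover from 4 have "a \<noteq> b" by blast
    ultimately show ?thesis using 4 by (simp add: proj_step_def doubleton_eq_iff)
  qed
qed

lemma proj_comtrace_equiv:
  assumes "comtrace_alphabet \<Theta>" "comtrace_equiv \<Theta> w v" "(a, b) \<notin> ind \<Theta>"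
  shows "proj \<Theta> a b v = proj \<Theta> a b w"
proof -
  have one: "proj \<Theta> a b x = proj \<Theta> a b y" if "serialises \<Theta> x y" for x y
    using that
  proof cases
    case (1 u z A B)
    from proj_step_union[OF assms(1) 1(5-7) assms(3)] show ?thesis
      by (simp add: 1(1,2) proj_def)
  qed
  from assms(2) show ?thesis
    unfolding comtrace_equiv_def
    by (induction rule: equivclp_induct) (auto dest: one)
qed

lemma projection_rep_comtrace:
  assumes "comtrace_alphabet \<Theta>" "(a, b) \<in> (actions \<Theta> \<times> actions \<Theta>) - ind \<Theta>"
  shows "projection_rep \<Theta> (comtrace \<Theta> w) (a, b) = proj \<Theta> a b w"
proof -
  have "w \<in> comtrace \<Theta> w"
    by (simp add: comtrace_def comtrace_equiv_def)
  moreover have "proj \<Theta> a b v = proj \<Theta> a b w" if "v \<in> comtrace \<Theta> w" for v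
    using that assms(2) unfolding comtrace_def by (blast intro: proj_comtrace_equiv[OF assms(1)])
  ultimately have "proj \<Theta> a b ` comtrace \<Theta> w = {proj \<Theta> a b w}"
    by blast
  then show ?thesis
    using assms(2) by (simp add: projection_rep_def)
qed

end

theory Submission
  imports Defs
begin

text \<open>Every projection starts with the letters contributed by the first step. Hence all
  actions of the first step are conditionally possible, and the first step is closed under
  the relation \<open>cnd\<close>: an action of the first step only waits for actions of the same step.
  Impossibility therefore cannot propagate into it.\<close>

text \<open>The case \<open>b = a\<close> matters because \<open>sim\<close> is irreflexive: each
  action depends on itself, so the conditions in \<open>cpa\<close> include the diagonal.\<close>

lemma proj_step_singleton:
  assumes "a \<in> A" "b \<notin> A \<or> b = a"
  shows "proj_step \<Theta> a b A = [Act a]"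
proof -
  have "{a, b} \<inter> A = {a}" using assms by blast
  then show ?thesis by (simp add: proj_step_def)
qed

text \<open>The tests in \<open>proj_step\<close> are made in a fixed order. Each branch is reached
  because \<open>wdp\<close> is asymmetric and \<open>ssm\<close> is disjoint from
  \<open>wdp\<close> and its converse.\<close>

lemma proj_step_both:
  assumes "a \<in> A" "b \<in> A" "a \<noteq> b"
  shows "(a, b) \<in> wdp \<Theta> \<Longrightarrow> proj_step \<Theta> a b A = [Act b, Act a]"
    and "(b, a) \<in> wdp \<Theta> \<Longrightarrow> proj_step \<Theta> a b A = [Act a, Act b]"
    and "(a, b) \<in> ssm \<Theta> \<Longrightarrow> proj_step \<Theta> a b A = [Perp]"
proof -
  have A: "{a, b} \<inter> A = {a, b}" "{a, b} \<noteq> {a}" "{a, b} \<noteq> {b}"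
    using assms by blast+
  then show "(a, b) \<in> wdp \<Theta> \<Longrightarrow> proj_step \<Theta> a b A = [Act b, Act a]"
    by (simp add: proj_step_def)
  have "(b, a) \<in> wdp \<Theta> \<Longrightarrow> (a, b) \<notin> wdp \<Theta>"
    by (auto simp: wdp_def)
  with A show "(b, a) \<in> wdp \<Theta> \<Longrightarrow> proj_step \<Theta> a b A = [Act a, Act b]"
    by (simp add: proj_step_def)
  have "(a, b) \<in> ssm \<Theta> \<Longrightarrow> (a, b) \<notin> wdp \<Theta> \<and> (b, a) \<notin> wdp \<Theta>"
    by (auto simp: ssm_def wdp_def)
  with A show "(a, b) \<in> ssm \<Theta> \<Longrightarrow> proj_step \<Theta> a b A = [Perp]"
    by (simp add: proj_step_def)
qed

text \<open>Ensures that \<open>projection_rep\<close> is evaluated inside its domain, where it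
  agrees with \<open>proj\<close>. Irreflexivity of \<open>sim\<close> separates \<open>a\<close>
  from \<open>b\<close> in all cases but \<open>dep\<close>.\<close>

lemma non_ind_relations:
  assumes "comtrace_alphabet \<Theta>"
  shows "(a, b) \<in> dep \<Theta> \<Longrightarrow> (a, b) \<in> actions \<Theta> \<times> actions \<Theta> - ind \<Theta>"
    and "(a, b) \<in> wdp \<Theta> \<Longrightarrow> (a, b) \<in> actions \<Theta> \<times> actions \<Theta> - ind \<Theta> \<and> a \<noteq> b"
    and "(b, a) \<in> wdp \<Theta> \<Longrightarrow> (a, b) \<in> actions \<Theta> \<times> actions \<Theta> - ind \<Theta> \<and> a \<noteq> b"
    and "(a, b) \<in> ssm \<Theta> \<Longrightarrow> (a, b) \<in> actions \<Theta> \<times> actions \<Theta> - ind \<Theta> \<and> a \<noteq> b"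
  using assms
  by (auto simp: comtrace_alphabet_def dep_def wdp_def ssm_def ind_def irrefl_def)

lemma first_step_subset_cpa:
  assumes \<Theta>: "comtrace_alphabet \<Theta>" and A: "A \<in> steps \<Theta>"
  shows "A \<subseteq> cpa \<Theta> (projection_rep \<Theta> (comtrace \<Theta> (A # v)))"
proof
  fix a assume a: "a \<in> A"
  let ?P = "projection_rep \<Theta> (comtrace \<Theta> (A # v))"
  note P = projection_rep_comtrace[OF \<Theta>, of _ _ "A # v"]
  have "take 1 (?P (a, b)) = [Act a]" if "(a, b) \<in> dep \<Theta>" for b
  proof -
    \<comment> \<open>Distinct members of a step are related by \<open>sim\<close>, hence not
      dependent.\<close>
    have "b \<notin> A \<or> b = a" using that A a by (auto simp: dep_def steps_def)
    with P[OF non_ind_relations(1)[OF \<Theta> that]] a show ?thesis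
      by (simp add: proj_def proj_step_singleton)
  qed
  \<comment> \<open>For the other three relations \<open>b\<close> may share the step with
    \<open>a\<close>. Then \<open>A\<close> contributes ab, ba or \<open>Perp\<close> respectively,
    just what \<open>cpa\<close> admits; otherwise it contributes the single letter
    \<open>Act a\<close>.\<close>
  moreover have "take 1 (?P (a, b)) = [Act a]" if "(b, a) \<in> wdp \<Theta>" for b
    using P[of a b] non_ind_relations(3)[OF \<Theta> that] that a
    by (cases "b \<in> A") (simp_all add: proj_def proj_step_singleton proj_step_both(2))
  moreover have "take 1 (?P (a, b)) = [Act a] \<or> take 2 (?P (a, b)) = [Act b, Act a]"
    if "(a, b) \<in> wdp \<Theta>" for b
    using P[of a b] non_ind_relations(2)[OF \<Theta> that] that a
    by (cases "b \<in> A") (simp_all add: proj_def proj_step_singleton proj_step_both(1))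
  moreover have "take 1 (?P (a, b)) = [Act a] \<or> take 1 (?P (a, b)) = [Perp]"
    if "(a, b) \<in> ssm \<Theta>" for b
    using P[of a b] non_ind_relations(4)[OF \<Theta> that] that a
    by (cases "b \<in> A") (simp_all add: proj_def proj_step_singleton proj_step_both(3))
  ultimately show "a \<in> cpa \<Theta> ?P"
    using A a by (auto simp: cpa_def steps_def)
qed

lemma first_step_cnd_closed:
  assumes \<Theta>: "comtrace_alphabet \<Theta>" and a: "a \<in> A"
    and cnd: "(a, b) \<in> cnd \<Theta> (projection_rep \<Theta> (comtrace \<Theta> (A # v)))"
  shows "b \<in> A"
proof (rule ccontr)
  assume b: "b \<notin> A"
  have "(a, b) \<in> wdp \<Theta> \<or> (a, b) \<in> ssm \<Theta>"
    using cnd by (auto simp: cnd_def)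
  then have "(a, b) \<in> actions \<Theta> \<times> actions \<Theta> - ind \<Theta>" "a \<noteq> b"
    using non_ind_relations[OF \<Theta>] by blast+
  \<comment> \<open>Without \<open>b\<close> in \<open>A\<close> the projection starts with
    \<open>Act a\<close>, whereas \<open>cnd\<close> requires it to start with \<open>Act b\<close>
    or \<open>Perp\<close>.\<close>
  with projection_rep_comtrace[OF \<Theta> this(1), of "A # v"] cnd a b show False
    by (auto simp: cnd_def proj_def proj_step_singleton)
qed

theorem theorem4p5:
  fixes \<Theta> :: "'a comtrace_alphabet" and w :: "'a set list"
  assumes "comtrace_alphabet \<Theta>" and "w \<in> lists (steps \<Theta>)" and "w \<noteq> []"
  shows "hd w \<subseteq> possible \<Theta> (projection_rep \<Theta> (comtrace \<Theta> w))"
proof -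
  obtain A v where w: "w = A # v" using assms(3) by (cases w) auto
  then have A: "A \<in> steps \<Theta>" using assms(2) by simp
  let ?P = "projection_rep \<Theta> (comtrace \<Theta> (A # v))"
  \<comment> \<open>Rule induction on \<open>imp\<close>: in the propagation case, \<open>a\<close>
    in \<open>A\<close> would put \<open>b\<close> in \<open>A\<close>, against the induction
    hypothesis.\<close>
  have "a \<notin> A" if "a \<in> imp \<Theta> ?P" for a
    using that
  proof induction
    case (base a)
    then show ?case using first_step_subset_cpa[OF assms(1) A] by blast
  next
    case (step b a)
    then show ?case using first_step_cnd_closed[OF assms(1)] by blast
  qed
  with A show ?thesis
    by (auto simp: w possible_def steps_def)
qed

end
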